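(* Let $R$ be a finite commutative Frobenius ring with $q$ elements, and let $C\subseteq R^N$ be a linear $P_R$-code over a poset $P$ of size $N$ with $s$ levels of sizes $n_1,\dots,n_s$ (so $N=n_1+\cdots+n_s$). Then the poset level weight enumerator of the dual code $C^\perp$ satisfies $$P_W\left(C^\perp\mid z_1,\dots,z_s\right)=\frac{1}{|C|}\sum_{l}A_l\prod_{j=1}^{s}\left(\sum_{p_j=0}^{n_j}\left\{\sum_{a_j=0}^{p_j}(-1)^{a_j}(q-1)^{p_j-a_j}\binom{l_j}{a_j}\binom{n_j-l_j}{p_j-a_j}\right\}z_j^{p_j}\right),$$ where the sum $\sum_l$ runs over all $l=(l_1,\dots,l_s)$ with $0\le l_j\le n_j$ for each $j$, and $A_l$ is the number of codewords of $C$ having Hamming weight spectrum vector $l$.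
   Context: All rings are finite commutative Frobenius rings (a finite commutative ring $R$ is Frobenius if its character group $\widehat R=\mathrm{Hom}_{\mathbb Z}(R,\mathbb C^\times)$ is isomorphic to $R$ as an $R$-module). A linear code $C$ is an $R$-submodule of $R^N$. The coordinates of $R^N$ are labelled by the elements of a finite poset $P$ of size $N$, which is partitioned into $s$ levels, the $i$th level having $n_i\ge 1$ elements. Such a $C$ is called a linear $P_R$-code. The poset enters only through this partition of the coordinate set. Each $u\in R^N$ is written $u=(u^1,\dots,u^s)$, with $u^i=(u_{i1},\dots,u_{in_i})\in R^{n_i}$ the part of $u$ in level $i$. The inner product is $\langle u,v\rangle=\sum_{i=1}^s\sum_{j=1}^{n_i}u_{ij}v_{ij}$, and $C^\perp=\{v\in R^N:\langle u,v\rangle=0\text{ for all }u\in C\}$. $w$ denotes the Hamming weight (number of nonzero coordinates). The Hamming weight spectrum vector of $u\in R^N$ is $(w(u^1),\dots,w(u^s))$. Let $z_1,\dots,z_s$ be commuting indeterminates. The poset level weight enumerator of a linear $P_R$-code $C$ is $$P_W\left(C\mid z_1,\dots,z_s\right)=\sum_{u\in C}\prod_{i=1}^{s}z_i^{w(u^i)},$$ and that of $C^\perp$ is defined by the same formula with $C^\perp$ in place of $C$ (same levels). Binomial conventions: $\binom{n}{k}=0$ if $n<k$ and $\binom00=1$. *)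

theory Defs
  imports "HOL-Analysis.Analysis" "HOL-Library.Poly_Mapping" "HOL-Library.FuncSet"
    "HOL-Library.Disjoint_Sets"
begin

text \<open>The group \<open>Hom\<^sub>\<int>(R, \<complex>\<^sup>\<times>)\<close>, under pointwise multiplication.\<close>

definition characters :: "('a::comm_ring_1 \<Rightarrow> complex) set" where
  "characters = {\<psi>. (\<forall>x. \<psi> x \<noteq> 0) \<and> (\<forall>x y. \<psi> (x + y) = \<psi> x * \<psi> y)}"

text \<open>The \<open>R\<close>-module structure on the character group: \<open>(r \<cdot> \<psi>)(x) = \<psi>(r x)\<close>.\<close>

definition char_scale :: "'a::comm_ring_1 \<Rightarrow> ('a \<Rightarrow> complex) \<Rightarrow> ('a \<Rightarrow> complex)" where
  "char_scale r \<psi> = (\<lambda>x. \<psi> (r * x))"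

text \<open>The witness \<open>\<phi>\<close> is an \<open>R\<close>-module isomorphism from \<open>R\<close> onto its character group; it sends
  the addition of \<open>R\<close> to the pointwise product. Finiteness is left to the type class \<open>finite\<close>.\<close>

definition frobenius_ring :: "'a::{finite, comm_ring_1} itself \<Rightarrow> bool" where
  "frobenius_ring _ \<longleftrightarrow> (\<exists>\<phi> :: 'a \<Rightarrow> 'a \<Rightarrow> complex.
     bij_betw \<phi> UNIV characters \<and>
     (\<forall>a b. \<phi> (a + b) = (\<lambda>x. \<phi> a x * \<phi> b x)) \<and>
     (\<forall>r a. \<phi> (r * a) = char_scale r (\<phi> a)))"

text \<open>Coordinates are labelled by the elements of the (finite) index type \<open>'p\<close>, so \<open>R\<^sup>N\<close> is
  \<open>'a ^ 'p\<close>. The library's \<open>module.subspace\<close> is the notion of a submodule; the following lemma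
  discharges its locale assumption.\<close>

lemma module_vector_scalar_mult:
  "module (vector_scalar_mult :: 'a::comm_ring_1 \<Rightarrow> 'a ^ 'p \<Rightarrow> 'a ^ 'p)"
  by unfold_locales (simp_all add: vec_eq_iff algebra_simps)

definition linear_code :: "('a::comm_ring_1 ^ 'p) set \<Rightarrow> bool" where
  "linear_code C \<longleftrightarrow> module.subspace vector_scalar_mult C"

definition code_inner :: "'a::comm_ring_1 ^ 'p \<Rightarrow> 'a ^ 'p \<Rightarrow> 'a" where
  "code_inner u v = (\<Sum>x\<in>UNIV. u $ x * v $ x)"

definition dual_code :: "('a::comm_ring_1 ^ 'p) set \<Rightarrow> ('a ^ 'p) set" where
  "dual_code C = {v. \<forall>u\<in>C. code_inner u v = 0}"

text \<open>\<open>L 1, \<dots>, L s\<close> partition the coordinate set into nonempty levels; \<open>L\<close> is irrelevant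
  outside \<open>{1..s}\<close>.\<close>

definition level_partition :: "nat \<Rightarrow> (nat \<Rightarrow> 'p set) \<Rightarrow> bool" where
  "level_partition s L \<longleftrightarrow>
     (\<Union>i\<in>{1..s}. L i) = UNIV \<and> disjoint_family_on L {1..s} \<and> (\<forall>i\<in>{1..s}. L i \<noteq> {})"

text \<open>The Hamming weight of the part of \<open>u\<close> with coordinates in \<open>A\<close>; thus \<open>w(u\<^sup>i)\<close> is
  \<open>hamming_weight (L i) u\<close>.\<close>

definition hamming_weight :: "'p set \<Rightarrow> 'a::zero ^ 'p \<Rightarrow> nat" where
  "hamming_weight A u = card {x\<in>A. u $ x \<noteq> 0}"

text \<open>Vectors indexed by \<open>{1..s}\<close> are extensional functions, so that they can be compared by
  equality and enumerated by \<open>PiE\<close>.\<close>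

definition weight_spectrum :: "nat \<Rightarrow> (nat \<Rightarrow> 'p set) \<Rightarrow> 'a::zero ^ 'p \<Rightarrow> nat \<Rightarrow> nat" where
  "weight_spectrum s L u = (\<lambda>i\<in>{1..s}. hamming_weight (L i) u)"

definition spectrum_count ::
    "nat \<Rightarrow> (nat \<Rightarrow> 'p set) \<Rightarrow> ('a::zero ^ 'p) set \<Rightarrow> (nat \<Rightarrow> nat) \<Rightarrow> nat" where
  "spectrum_count s L C l = card {u\<in>C. weight_spectrum s L u = l}"

text \<open>Polynomials in the commuting indeterminates \<open>z\<^sub>0, z\<^sub>1, \<dots>\<close>, as finitely supported
  functions from monomials (exponent vectors) to coefficients. All coefficients occurring here
  are rational; \<open>\<complex>\<close> serves as the coefficient field.\<close>

type_synonym cpoly = "(nat \<Rightarrow>\<^sub>0 nat) \<Rightarrow>\<^sub>0 complex"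

definition indet :: "nat \<Rightarrow> cpoly" where
  "indet i = Poly_Mapping.single (Poly_Mapping.single i 1) 1"

definition const_poly :: "complex \<Rightarrow> cpoly" where
  "const_poly c = Poly_Mapping.single 0 c"

definition level_weight_enumerator ::
    "nat \<Rightarrow> (nat \<Rightarrow> 'p set) \<Rightarrow> ('a::zero ^ 'p) set \<Rightarrow> cpoly" where
  "level_weight_enumerator s L C = (\<Sum>u\<in>C. \<Prod>i=1..s. indet i ^ hamming_weight (L i) u)"

end

theory Submission
  imports Defs
begin

text \<open>A Frobenius ring carries a generating character \<open>\<psi>\<close>, i.e. one that is trivial on no nonzero
  ideal. Summing \<open>\<psi> \<langle>u, v\<rangle>\<close> over \<open>u \<in> C\<close> therefore gives \<open>|C|\<close> times the indicator of
  \<open>v \<in> C\<^sup>\<bottom>\<close>. Multiplying by the weight monomial of \<open>v\<close> and summing over all \<open>v\<close>, the sum over \<open>v\<close>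
  factorises over the coordinates: a coordinate \<open>x\<close> in level \<open>i\<close> contributes \<open>1 + (q - 1) z\<^sub>i\<close> if
  \<open>u\<^sub>x = 0\<close> and \<open>1 - z\<^sub>i\<close> otherwise. Expanding the resulting
  \<open>(1 - z\<^sub>i)\<^bsup>l\<^esup> (1 + (q - 1) z\<^sub>i)\<^bsup>n - l\<^esup>\<close> produces the Krawtchouk coefficients.\<close>

section \<open>Constant polynomials and Krawtchouk coefficients\<close>

lemma const_poly_0 [simp]: "const_poly 0 = 0"
  and const_poly_1 [simp]: "const_poly 1 = 1"
  and const_poly_of_nat [simp]: "const_poly (of_nat k) = of_nat k"
  and const_poly_add: "const_poly (a + b) = const_poly a + const_poly b"
  and const_poly_diff: "const_poly (a - b) = const_poly a - const_poly b"
  and const_poly_minus: "const_poly (- a) = - const_poly a"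
  and const_poly_mult: "const_poly (a * b) = const_poly a * const_poly b"
  by (simp_all add: const_poly_def single_add single_diff single_uminus mult_single)

lemma const_poly_power: "const_poly (a ^ k) = const_poly a ^ k"
  by (induction k) (simp_all add: const_poly_mult)

lemma const_poly_sum: "const_poly (sum f A) = (\<Sum>x\<in>A. const_poly (f x))"
  by (induction A rule: infinite_finite_induct) (simp_all add: const_poly_add)

lemma const_poly_prod: "const_poly (prod f A) = (\<Prod>x\<in>A. const_poly (f x))"
  by (induction A rule: infinite_finite_induct) (simp_all add: const_poly_mult)

text \<open>Cauchy product of two binomial expansions; the inner sums are Krawtchouk values. Later
  \<open>z\<close> is an indeterminate and \<open>c\<close> is \<open>q - 1\<close> as a
  polynomial.\<close>

lemma krawtchouk_expansion:
  fixes c z :: "'b::idom"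
  shows "(1 - z) ^ l * (1 + c * z) ^ m =
    (\<Sum>p=0..l + m. (\<Sum>a=0..p. (- 1) ^ a * c ^ (p - a) *
       of_nat (l choose a) * of_nat (m choose (p - a))) * z ^ p)"
proof -
  have l: "(1 - z) ^ l = (\<Sum>i\<le>l. ((- 1) ^ i * of_nat (l choose i)) * z ^ i)"
    using binomial_ring[of "- z" 1 l] by (simp add: power_minus[of z] mult_ac)
  have m: "(1 + c * z) ^ m = (\<Sum>j\<le>m. (c ^ j * of_nat (m choose j)) * z ^ j)"
    using binomial_ring[of "c * z" 1 m] by (simp add: power_mult_distrib mult_ac add.commute)
  have "(1 - z) ^ l * (1 + c * z) ^ m =
      (\<Sum>p\<le>l + m. (\<Sum>a\<le>p. ((- 1) ^ a * of_nat (l choose a)) *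
         (c ^ (p - a) * of_nat (m choose (p - a)))) * z ^ p)"
    \<comment> \<open>The product rule needs both coefficient sequences to vanish beyond
      \<open>l\<close> and \<open>m\<close>, as binomial coefficients do.\<close>
    unfolding l m by (rule polynomial_product) (simp_all add: binomial_eq_0)
  then show ?thesis
    by (simp add: atLeast0AtMost mult_ac)
qed

section \<open>Characters and generating characters\<close>

lemma character_0:
  assumes "\<psi> \<in> characters"
  shows "\<psi> 0 = 1"
proof -
  have "\<psi> 0 \<noteq> 0" "\<psi> (0 + 0) = \<psi> 0 * \<psi> 0"
    using assms unfolding characters_def by blast+
  then show ?thesis
    by simp
qed

lemma character_add: "\<psi> \<in> characters \<Longrightarrow> \<psi> (x + y) = \<psi> x * \<psi> y"
  by (simp add: characters_def)

lemma character_sum: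
  assumes "\<psi> \<in> characters"
  shows "\<psi> (sum f A) = (\<Prod>x\<in>A. \<psi> (f x))"
  by (induction A rule: infinite_finite_induct)
    (simp_all add: character_0[OF assms] character_add[OF assms])

text \<open>The elements \<open>r * a\<close> form the principal ideal of \<open>a\<close>. Every
  nonzero ideal contains a nonzero principal one, so testing these suffices.\<close>

definition generating_character :: "('a::comm_ring_1 \<Rightarrow> complex) \<Rightarrow> bool" where
  "generating_character \<psi> \<longleftrightarrow> \<psi> \<in> characters \<and> (\<forall>a. (\<forall>r. \<psi> (r * a) = 1) \<longrightarrow> a = 0)"

text \<open>The image of 1 under the module isomorphism works: if it is trivial on the ideal of
  \<open>a\<close>, then \<open>\<phi> a\<close>, its multiple by \<open>a\<close>, is the trivial
  character \<open>\<phi> 0\<close>, and injectivity gives \<open>a = 0\<close>.\<close>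

lemma frobenius_ring_generating_character:
  assumes "frobenius_ring TYPE('a::{finite, comm_ring_1})"
  obtains \<psi> :: "'a::{finite, comm_ring_1} \<Rightarrow> complex" where "generating_character \<psi>"
proof -
  obtain \<phi> :: "'a \<Rightarrow> 'a \<Rightarrow> complex" where bij: "bij_betw \<phi> UNIV characters"
    and scale: "\<And>r a. \<phi> (r * a) = char_scale r (\<phi> a)"
    using assms unfolding frobenius_ring_def by blast
  have \<phi>: "\<phi> a x = \<phi> 1 (x * a)" for a x
    using scale[of a 1] by (simp add: char_scale_def mult.commute)
  have 1: "\<phi> 1 \<in> characters"
    using bij by (auto simp: bij_betw_def)
  have "a = 0" if "\<forall>r. \<phi> 1 (r * a) = 1" for a
  proof -
    have "\<phi> a = \<phi> 0"
      using that character_0[OF 1] by (intro ext) (simp add: \<phi>[of a] \<phi>[of 0])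
    then show ?thesis
      using bij by (auto simp: bij_betw_def dest: injD)
  qed
  with 1 show ?thesis
    using that by (auto simp: generating_character_def)
qed

section \<open>Orthogonality relations\<close>

text \<open>Translation by \<open>w\<close> permutes \<open>C\<close>, so the sum equals
  \<open>f w\<close> times itself. Applied to a code and to the whole ring.\<close>

lemma sum_eq_0_if_nontrivial_shift:
  fixes f :: "'b::ab_group_add \<Rightarrow> complex"
  assumes add: "\<And>u v. u \<in> C \<Longrightarrow> v \<in> C \<Longrightarrow> u + v \<in> C"
    and diff: "\<And>u v. u \<in> C \<Longrightarrow> v \<in> C \<Longrightarrow> u - v \<in> C"
    and mult: "\<And>u v. f (u + v) = f u * f v"
    and w: "w \<in> C" "f w \<noteq> 1"
  shows "sum f C = 0"
proof -
  have "sum f C = (\<Sum>u\<in>C. f (w + u))"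
    using w(1) add diff
    by (intro sum.reindex_bij_witness[of _ "\<lambda>u. w + u" "\<lambda>u. u - w"]) auto
  also have "\<dots> = f w * sum f C"
    by (simp add: mult sum_distrib_left)
  finally show ?thesis
    using w(2) by simp
qed

lemma code_inner_add: "code_inner (u + u') v = code_inner u v + code_inner u' v"
  by (simp add: code_inner_def distrib_right sum.distrib)

lemma code_inner_scale: "code_inner (r *s u) v = r * code_inner u v"
  by (simp add: code_inner_def sum_distrib_left mult.assoc)

lemma linear_code_add: "linear_code C \<Longrightarrow> u \<in> C \<Longrightarrow> v \<in> C \<Longrightarrow> u + v \<in> C"
  and linear_code_scale: "linear_code C \<Longrightarrow> u \<in> C \<Longrightarrow> r *s u \<in> C"
  and linear_code_diff: "linear_code C \<Longrightarrow> u \<in> C \<Longrightarrow> v \<in> C \<Longrightarrow> u - v \<in> C"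
  and linear_code_0: "linear_code C \<Longrightarrow> 0 \<in> C"
  unfolding linear_code_def
  by (simp_all add: module.subspace_add[OF module_vector_scalar_mult]
      module.subspace_scale[OF module_vector_scalar_mult]
      module.subspace_diff[OF module_vector_scalar_mult]
      module.subspace_0[OF module_vector_scalar_mult])

lemma sum_character_code_inner:
  fixes C :: "('a::{finite, comm_ring_1} ^ 'p) set"
  assumes "generating_character \<psi>" and C: "linear_code C"
  shows "(\<Sum>u\<in>C. \<psi> (code_inner u v)) = (if v \<in> dual_code C then of_nat (card C) else 0)"
proof (cases "v \<in> dual_code C")
  case True
  then show ?thesis
    using assms(1) by (simp add: dual_code_def generating_character_def character_0)
next
  case False
  then obtain u where u: "u \<in> C" "code_inner u v \<noteq> 0"
    by (auto simp: dual_code_def)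
  \<comment> \<open>\<open>\<psi>\<close> is nontrivial on the ideal of the nonzero inner product;
    scalar closure of \<open>C\<close> turns the multiplier \<open>r\<close> into a codeword to
    shift by.\<close>
  then obtain r where "\<psi> (code_inner (r *s u) v) \<noteq> 1"
    using assms(1) by (auto simp: generating_character_def code_inner_scale)
  then have "(\<Sum>u\<in>C. \<psi> (code_inner u v)) = 0"
    using assms(1) u(1) C
    by (intro sum_eq_0_if_nontrivial_shift[where w = "r *s u"])
      (auto simp: linear_code_add linear_code_diff linear_code_scale
        code_inner_add generating_character_def character_add)
  with False show ?thesis
    by simp
qed

section \<open>Factorisation over coordinates and levels\<close>

lemma sum_vec_prod_distrib:
  fixes g :: "'p::finite \<Rightarrow> 'a::finite \<Rightarrow> 'b::comm_semiring_1"
  shows "(\<Sum>v\<in>UNIV. \<Prod>x\<in>UNIV. g x (v $ x)) = (\<Prod>x\<in>UNIV. \<Sum>a\<in>UNIV. g x a)"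
proof -
  have "(\<Prod>x\<in>UNIV. \<Sum>a\<in>UNIV. g x a) = (\<Sum>f\<in>UNIV. \<Prod>x\<in>UNIV. g x (f x))"
    by (subst prod_sum_PiE) auto
  also have "\<dots> = (\<Sum>v\<in>UNIV. \<Prod>x\<in>UNIV. g x (v $ x))"
    by (intro sum.reindex_bij_witness[of _ vec_nth vec_lambda]) auto
  finally show ?thesis ..
qed

lemma power_hamming_weight:
  fixes v :: "'a::zero ^ 'p::finite"
  shows "z ^ hamming_weight A v = (\<Prod>x\<in>A. if v $ x = 0 then 1 else z :: 'b::comm_monoid_mult)"
proof -
  have "z ^ hamming_weight A v = (\<Prod>x\<in>{x \<in> A. v $ x \<noteq> 0}. z)"
    by (simp add: hamming_weight_def)
  also have "\<dots> = (\<Prod>x\<in>A. if v $ x \<noteq> 0 then z else 1)"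
    by (rule prod.inter_filter) simp
  finally show ?thesis
    by (auto intro: prod.cong)
qed

lemma prod_level_partition:
  fixes L :: "nat \<Rightarrow> 'p::finite set"
  assumes "level_partition s L"
  shows "(\<Prod>x\<in>UNIV. f x) = (\<Prod>i=1..s. \<Prod>x\<in>L i. f x)"
  using assms prod.UNION_disjoint_family[of "{1..s}" L f]
  by (simp add: level_partition_def)

text \<open>With a level function the weight monomial becomes a single product over all coordinates,
  the form that \<open>sum_vec_prod_distrib\<close> requires. Disjointness makes the level
  unique.\<close>

lemma level_partition_index:
  assumes "level_partition s L"
  obtains lv where "\<And>i x. i \<in> {1..s} \<Longrightarrow> x \<in> L i \<Longrightarrow> lv x = i"
proof
  fix i x
  assume i: "i \<in> {1..s}" "x \<in> L i"
  show "(THE i. i \<in> {1..s} \<and> x \<in> L i) = i"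
    using assms i by (intro the_equality) (fastforce simp: level_partition_def disjoint_family_on_def)+
qed

lemma sum_generating_character_weight:
  fixes \<psi> :: "'a::{finite, comm_ring_1} \<Rightarrow> complex"
  assumes "generating_character \<psi>"
  shows "(\<Sum>a\<in>UNIV. const_poly (\<psi> (b * a)) * (if a = 0 then 1 else z)) =
    (if b = 0 then 1 + (of_nat CARD('a) - 1) * z else 1 - z)"
proof -
  have \<psi>: "\<psi> \<in> characters"
    using assms by (simp add: generating_character_def)
  have sum: "(\<Sum>a\<in>UNIV. \<psi> (b * a)) = (if b = 0 then of_nat CARD('a) else 0)"
  proof (cases "b = 0")
    case False
    then obtain r where "\<psi> (b * r) \<noteq> 1"
      using assms unfolding generating_character_def by (metis mult.commute)
    then have "(\<Sum>a\<in>UNIV. \<psi> (b * a)) = 0"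
      by (intro sum_eq_0_if_nontrivial_shift[where w = r])
        (auto simp: distrib_left character_add[OF \<psi>])
    with False show ?thesis
      by simp
  qed (simp add: character_0[OF \<psi>])
  \<comment> \<open>The weight factor is \<open>z\<close> everywhere plus a correction
    \<open>1 - z\<close> at \<open>a = 0\<close>, where the character is 1; what remains is
    \<open>z\<close> times a full character sum.\<close>
  have "(\<Sum>a\<in>UNIV. const_poly (\<psi> (b * a)) * (if a = 0 then 1 else z)) =
      (\<Sum>a\<in>UNIV. const_poly (\<psi> (b * a)) * z + (if a = 0 then 1 - z else 0))"
    by (intro sum.cong) (auto simp: character_0[OF \<psi>])
  also have "\<dots> = const_poly (\<Sum>a\<in>UNIV. \<psi> (b * a)) * z + (1 - z)"
    by (simp add: sum.distrib const_poly_sum sum_distrib_right)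
  finally show ?thesis
    unfolding sum by (simp add: algebra_simps split: if_splits)
qed

text \<open>The Fourier transform of the weight monomial, evaluated at \<open>u\<close>; it depends
  on \<open>u\<close> only through its level weights.\<close>

lemma sum_character_weight_monomial:
  fixes u :: "'a::{finite, comm_ring_1} ^ 'p::finite"
  assumes \<psi>: "generating_character \<psi>" and L: "level_partition s L"
  shows "(\<Sum>v\<in>UNIV. const_poly (\<psi> (code_inner u v)) *
      (\<Prod>i=1..s. indet i ^ hamming_weight (L i) v)) =
    (\<Prod>i=1..s. (1 - indet i) ^ hamming_weight (L i) u *
      (1 + (of_nat CARD('a) - 1) * indet i) ^ (card (L i) - hamming_weight (L i) u))"
proof -
  obtain lv where lv: "\<And>i x. i \<in> {1..s} \<Longrightarrow> x \<in> L i \<Longrightarrow> lv x = i"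
    using level_partition_index[OF L] by blast
  define Q where "Q i = 1 + (of_nat CARD('a) - 1) * indet i" for i
  have mono: "(\<Prod>i=1..s. indet i ^ hamming_weight (L i) v) =
      (\<Prod>x\<in>UNIV. if v $ x = 0 then 1 else indet (lv x))" for v :: "'a ^ 'p"
    by (auto simp: prod_level_partition[OF L] power_hamming_weight lv intro!: prod.cong)
  have char: "const_poly (\<psi> (code_inner u v)) = (\<Prod>x\<in>UNIV. const_poly (\<psi> (u $ x * v $ x)))" for v
    using \<psi> by (simp add: generating_character_def code_inner_def character_sum const_poly_prod)
  have "(\<Sum>v\<in>UNIV. const_poly (\<psi> (code_inner u v)) *
      (\<Prod>i=1..s. indet i ^ hamming_weight (L i) v)) =
    (\<Sum>v\<in>UNIV. \<Prod>x\<in>UNIV. const_poly (\<psi> (u $ x * v $ x)) *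
      (if v $ x = 0 then 1 else indet (lv x)))"
    by (simp only: mono char prod.distrib)
  also have "\<dots> = (\<Prod>x\<in>UNIV. \<Sum>a\<in>UNIV. const_poly (\<psi> (u $ x * a)) *
      (if a = 0 then 1 else indet (lv x)))"
    by (rule sum_vec_prod_distrib)
  also have "\<dots> = (\<Prod>x\<in>UNIV. if u $ x = 0 then Q (lv x) else 1 - indet (lv x))"
    by (simp only: sum_generating_character_weight[OF \<psi>] Q_def)
  also have "\<dots> = (\<Prod>i=1..s. \<Prod>x\<in>L i. if u $ x = 0 then Q i else 1 - indet i)"
    unfolding prod_level_partition[OF L] by (intro prod.cong refl) (simp add: lv)
  also have "\<dots> = (\<Prod>i=1..s. (1 - indet i) ^ hamming_weight (L i) u *
      Q i ^ (card (L i) - hamming_weight (L i) u))"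
  proof (rule prod.cong)
    fix i
    \<comment> \<open>Shaped to match the two index sets into which \<open>prod.If_cases\<close>
      splits the product.\<close>
    have "L i \<inter> - {x. u $ x = 0} = {x \<in> L i. u $ x \<noteq> 0}"
      by blast
    then have "card (L i \<inter> - {x. u $ x = 0}) = hamming_weight (L i) u"
      by (simp add: hamming_weight_def)
    moreover from this have "card (L i \<inter> {x. u $ x = 0}) = card (L i) - hamming_weight (L i) u"
      using card_Int_Diff[of "L i" "{x. u $ x = 0}"] by (simp add: Diff_eq)
    ultimately show "(\<Prod>x\<in>L i. if u $ x = 0 then Q i else 1 - indet i) =
        (1 - indet i) ^ hamming_weight (L i) u * Q i ^ (card (L i) - hamming_weight (L i) u)"
      by (simp add: prod.If_cases mult.commute)
  qed simp
  finally show ?thesis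
    by (simp only: Q_def)
qed

lemma hamming_weight_le: "hamming_weight A u \<le> card A" for u :: "'a::zero ^ 'p::finite"
  unfolding hamming_weight_def by (rule card_mono) auto

section \<open>The MacWilliams identity and grouping by spectrum\<close>

theorem macwilliams_level_weight_enumerator:
  fixes C :: "('a::{finite, comm_ring_1} ^ 'p::finite) set"
  assumes "frobenius_ring TYPE('a)" and L: "level_partition s L" and C: "linear_code C"
  shows "of_nat (card C) * level_weight_enumerator s L (dual_code C) =
    (\<Sum>u\<in>C. \<Prod>i=1..s. (1 - indet i) ^ hamming_weight (L i) u *
      (1 + (of_nat CARD('a) - 1) * indet i) ^ (card (L i) - hamming_weight (L i) u))"
proof -
  obtain \<psi> :: "'a \<Rightarrow> complex" where \<psi>: "generating_character \<psi>"
    using frobenius_ring_generating_character[OF assms(1)] .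
  let ?m = "\<lambda>v :: 'a ^ 'p. \<Prod>i=1..s. indet i ^ hamming_weight (L i) v"
  have "of_nat (card C) * level_weight_enumerator s L (dual_code C) =
      (\<Sum>v\<in>dual_code C. of_nat (card C) * ?m v)"
    by (simp add: level_weight_enumerator_def sum_distrib_left)
  \<comment> \<open>By orthogonality the new terms, outside the dual, are zero.\<close>
  also have "\<dots> = (\<Sum>v\<in>UNIV. const_poly (\<Sum>u\<in>C. \<psi> (code_inner u v)) * ?m v)"
    by (intro sum.mono_neutral_cong_left)
      (simp_all add: sum_character_code_inner[OF \<psi> C])
  also have "\<dots> = (\<Sum>u\<in>C. \<Sum>v\<in>UNIV. const_poly (\<psi> (code_inner u v)) * ?m v)"
    by (simp only: const_poly_sum sum_distrib_right) (rule sum.swap)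
  finally show ?thesis
    by (simp only: sum_character_weight_monomial[OF \<psi> L])
qed

text \<open>Groups codewords into the fibres of the spectrum map, on which \<open>g\<close> is
  constant. The map lands in the \<open>PiE\<close> box because weights are bounded by level sizes
  and spectra are extensional.\<close>

lemma sum_spectrum_count:
  fixes C :: "('a::zero ^ 'p::finite) set" and g :: "(nat \<Rightarrow> nat) \<Rightarrow> 'b::comm_semiring_1"
  assumes "finite C" and "\<And>j. j \<in> {1..s} \<Longrightarrow> n j = card (L j)"
  shows "(\<Sum>l\<in>PiE {1..s} (\<lambda>j. {0..n j}). of_nat (spectrum_count s L C l) * g l) =
    (\<Sum>u\<in>C. g (weight_spectrum s L u))"
proof -
  have "(\<Sum>u\<in>C. g (weight_spectrum s L u)) =
      (\<Sum>l\<in>PiE {1..s} (\<lambda>j. {0..n j}). \<Sum>u\<in>{u \<in> C. weight_spectrum s L u = l}. g (weight_spectrum s L u))"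
    using assms
    by (intro sum.group[symmetric])
      (auto simp: weight_spectrum_def hamming_weight_le intro!: finite_PiE)
  then show ?thesis
    by (simp add: spectrum_count_def)
qed

theorem corollary4p1:
  fixes C :: "('a::{finite, comm_ring_1}, 'p::{finite, order}) vec set"
    and L :: "nat \<Rightarrow> 'p set" and n :: "nat \<Rightarrow> nat" and s q :: nat
  assumes "frobenius_ring TYPE('a)"
    and "q = CARD('a)"
    and "level_partition s L"
    and "\<And>j. j \<in> {1..s} \<Longrightarrow> n j = card (L j)"
    and "linear_code C"
  shows "level_weight_enumerator s L (dual_code C) =
    const_poly (1 / of_nat (card C)) *
    (\<Sum>l\<in>PiE {1..s} (\<lambda>j. {0..n j}).
       of_nat (spectrum_count s L C l) *
       (\<Prod>j=1..s. \<Sum>p=0..n j.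
          const_poly (\<Sum>a=0..p. (- 1) ^ a * (of_nat q - 1) ^ (p - a) *
            of_nat (l j choose a) * of_nat ((n j - l j) choose (p - a))) *
          indet j ^ p))"
proof -
  define K where "K l = (\<Prod>j=1..s. \<Sum>p=0..n j.
      const_poly (\<Sum>a=0..p. (- 1) ^ a * (of_nat q - 1) ^ (p - a) *
        of_nat (l j choose a) * of_nat ((n j - l j) choose (p - a))) * indet j ^ p)" for l
  have K_spectrum: "K (weight_spectrum s L u) = (\<Prod>i=1..s. (1 - indet i) ^ hamming_weight (L i) u *
      (1 + (of_nat CARD('a) - 1) * indet i) ^ (card (L i) - hamming_weight (L i) u))" for u :: "('a, 'p) vec"
    unfolding K_def
  proof (rule prod.cong)
    fix i
    assume i: "i \<in> {1..s}"
    let ?l = "hamming_weight (L i) u"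
    \<comment> \<open>The subtraction is truncated, so the weight bound is what makes the expansion
      end at degree \<open>n i\<close>.\<close>
    have "?l + (n i - ?l) = n i"
      using assms(4)[OF i] hamming_weight_le[of "L i" u] by simp
    then have "(1 - indet i) ^ ?l * (1 + (of_nat q - 1) * indet i) ^ (n i - ?l) =
      (\<Sum>p=0..n i. (\<Sum>a=0..p. (- 1) ^ a * (of_nat q - 1) ^ (p - a) *
        of_nat (?l choose a) * of_nat ((n i - ?l) choose (p - a))) * indet i ^ p)"
      using krawtchouk_expansion[of "indet i" ?l "of_nat q - 1" "n i - ?l"] by (simp only:)
    then show "(\<Sum>p=0..n i. const_poly (\<Sum>a=0..p. (- 1) ^ a * (of_nat q - 1) ^ (p - a) *
        of_nat (weight_spectrum s L u i choose a) *
        of_nat ((n i - weight_spectrum s L u i) choose (p - a))) * indet i ^ p) =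
      (1 - indet i) ^ ?l * (1 + (of_nat CARD('a) - 1) * indet i) ^ (card (L i) - ?l)"
      \<comment> \<open>The expansion was taken inside the polynomial ring;
        \<open>const_poly\<close> is pushed through the scalar coefficient to match it.\<close>
      using i assms(2) assms(4)[OF i]
      by (simp only: weight_spectrum_def restrict_apply if_True const_poly_sum const_poly_mult
          const_poly_power const_poly_diff const_poly_minus const_poly_1 const_poly_of_nat)
  qed simp
  \<comment> \<open>The zero word lies in the finite set \<open>C\<close>, so
    \<open>1 / of_nat (card C)\<close> is a true inverse and not the default value 0.\<close>
  have "card C \<noteq> 0"
    using linear_code_0[OF assms(5)] by auto
  then have "const_poly (1 / of_nat (card C)) * of_nat (card C) = 1"
    using const_poly_mult[of "1 / of_nat (card C)" "of_nat (card C)"] by simp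
  then have "level_weight_enumerator s L (dual_code C) = const_poly (1 / of_nat (card C)) *
      (of_nat (card C) * level_weight_enumerator s L (dual_code C))"
    by (simp only: mult.assoc[symmetric] mult_1_left)
  also have "of_nat (card C) * level_weight_enumerator s L (dual_code C) =
      (\<Sum>u\<in>C. K (weight_spectrum s L u))"
    by (simp only: K_spectrum macwilliams_level_weight_enumerator[OF assms(1,3,5)])
  also have "\<dots> = (\<Sum>l\<in>PiE {1..s} (\<lambda>j. {0..n j}). of_nat (spectrum_count s L C l) * K l)"
    using assms(4) by (intro sum_spectrum_count[where g = K, symmetric]) simp_all
  finally show ?thesis
    by (simp only: K_def)
qed

end
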